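(* Let $\alpha>1$ be a real number and let $m_1,m_\alpha$ be real numbers with $m_1>0$ and $m_\alpha>m_1^\alpha$. Define $$\underline q(m_1,m_\alpha,\alpha)=\left(\left(\frac{m_\alpha-m_1^\alpha}{m_1}\right)\left(\frac{\alpha-1}{\alpha}\right)^{\alpha-1}+m_1^{\alpha-1}\right)^{1/(\alpha-1)}.$$ Then for all $q>\underline q(m_1,m_\alpha,\alpha)$, $$\sup_{F\in\mathcal F_{1,\alpha}}\mathbb E_F[\tilde d-q]_+\;\ge\;\frac{(m_\alpha-m_1^\alpha)}{\alpha^\alpha q^{\alpha-1}}(\alpha-1)^{\alpha-1}.$$
   Context: $\mathcal F_{1,\alpha}$ denotes the set of all Borel probability distributions $F$ on $[0,\infty)$ with $\int_0^\infty w\,dF(w)=m_1$ and $\int_0^\infty w^\alpha\,dF(w)=m_\alpha$. For $F\in\mathcal F_{1,\alpha}$, $\tilde d$ denotes a random variable with distribution $F$, and $\mathbb E_F[\tilde d-q]_+=\int_0^\infty \max(0,w-q)\,dF(w)$. *)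

theory Defs
  imports "HOL-Probability.Probability"
begin

text \<open>
  A distribution on the half-line is a measure whose space is \<open>{0..}\<close> itself, so integrals
  over \<open>F\<close> are integrals from 0 to infinity. Integrability is explicit because the Bochner
  integral of a non-integrable function is 0 by convention.
\<close>

definition moment_class :: "real \<Rightarrow> real \<Rightarrow> real \<Rightarrow> real measure set" where
  "moment_class \<alpha> m\<^sub>1 m\<^sub>\<alpha> =
    {F. prob_space F \<and> sets F = sets (restrict_space borel {0..}) \<and>
        integrable F (\<lambda>w. w) \<and> (\<integral>w. w \<partial>F) = m\<^sub>1 \<and>
        integrable F (\<lambda>w. w powr \<alpha>) \<and> (\<integral>w. w powr \<alpha> \<partial>F) = m\<^sub>\<alpha>}"

definition expected_excess :: "real measure \<Rightarrow> real \<Rightarrow> real" where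
  "expected_excess F q = (\<integral>w. max 0 (w - q) \<partial>F)"

definition q_lower :: "real \<Rightarrow> real \<Rightarrow> real \<Rightarrow> real" where
  "q_lower m\<^sub>1 m\<^sub>\<alpha> \<alpha> =
    (((m\<^sub>\<alpha> - m\<^sub>1 powr \<alpha>) / m\<^sub>1) * ((\<alpha> - 1) / \<alpha>) powr (\<alpha> - 1) + m\<^sub>1 powr (\<alpha> - 1))
      powr (1 / (\<alpha> - 1))"

end

theory Submission
  imports Defs
begin

text \<open>
  It suffices to find a two-point distribution on \<open>x < m\<^sub>1 < y\<close> in the class, with
  \<open>y = \<alpha> q / (\<alpha> - 1)\<close>. Such a distribution gives weight \<open>p\<close> to \<open>y\<close> with
  \<open>p y\<^sup>\<alpha> \<ge> m\<^sub>\<alpha> - m\<^sub>1\<^sup>\<alpha>\<close>, so its expected excess is at least \<open>(m\<^sub>\<alpha> - m\<^sub>1\<^sup>\<alpha>) (y - q) / y\<^sup>\<alpha>\<close>,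
  which equals the claimed bound; this \<open>y\<close> maximizes \<open>(y - q) / y\<^sup>\<alpha>\<close>.
  Fixing \<open>y\<close> and the mean, the moment of order \<open>\<alpha>\<close> moves continuously from \<open>m\<^sub>1 y\<^sup>\<alpha>\<^sup>-\<^sup>1\<close> at
  \<open>x = 0\<close> to \<open>m\<^sub>1\<^sup>\<alpha>\<close> at \<open>x = m\<^sub>1\<close>. The hypothesis on \<open>q\<close> yields \<open>m\<^sub>1 y\<^sup>\<alpha>\<^sup>-\<^sup>1 > m\<^sub>\<alpha>\<close>, so the
  intermediate value theorem provides \<open>x\<close>.
\<close>

text \<open>The push-forward goes to \<open>restrict_space borel {0..}\<close> because
  \<open>moment_class\<close> prescribes exactly this sigma-algebra.\<close>

definition two_point :: "real \<Rightarrow> real \<Rightarrow> real \<Rightarrow> real measure" where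
  "two_point p x y =
    distr (measure_pmf (bernoulli_pmf p)) (restrict_space borel {0..}) (\<lambda>b. if b then y else x)"

lemma
  assumes "0 \<le> p" "p \<le> 1" "0 \<le> x" "0 \<le> y" and f: "f \<in> borel_measurable borel"
  shows integrable_two_point: "integrable (two_point p x y) (f :: real \<Rightarrow> real)"
    and integral_two_point: "(\<integral>w. f w \<partial>two_point p x y) = p * f y + (1 - p) * f x"
proof -
  have m: "(\<lambda>b. if b then y else x) \<in>
      measurable (measure_pmf (bernoulli_pmf p)) (restrict_space borel {0..})"
    using assms by (auto simp: space_restrict_space)
  have f': "f \<in> borel_measurable (restrict_space borel {0..})"
    using f by (rule measurable_restrict_space1)
  show "integrable (two_point p x y) f"
    unfolding two_point_def integrable_distr_eq[OF m f']
    by (rule integrable_measure_pmf_finite) simp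
  show "(\<integral>w. f w \<partial>two_point p x y) = p * f y + (1 - p) * f x"
    unfolding two_point_def integral_distr[OF m f'] using assms by simp
qed

lemma two_point_in_moment_class:
  assumes "0 \<le> p" "p \<le> 1" "0 \<le> x" "0 \<le> y"
    and "p * y + (1 - p) * x = m\<^sub>1" "p * y powr \<alpha> + (1 - p) * x powr \<alpha> = m\<^sub>\<alpha>"
  shows "two_point p x y \<in> moment_class \<alpha> m\<^sub>1 m\<^sub>\<alpha>"
proof -
  have "prob_space (two_point p x y)"
    unfolding two_point_def using assms
    by (intro prob_space.prob_space_distr prob_space_measure_pmf) (auto simp: space_restrict_space)
  moreover have "sets (two_point p x y) = sets (restrict_space borel {0..})"
    by (simp add: two_point_def)
  ultimately show ?thesis
    using assms
    by (simp add: moment_class_def integrable_two_point integral_two_point)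
qed

lemma exists_two_point:
  fixes \<alpha> m\<^sub>1 m\<^sub>\<alpha> y :: real
  assumes "\<alpha> > 1" "m\<^sub>1 > 0" "y > 0" "m\<^sub>\<alpha> > m\<^sub>1 powr \<alpha>" "m\<^sub>\<alpha> < m\<^sub>1 * y powr (\<alpha> - 1)"
  obtains p x where "0 \<le> p" "p \<le> 1" "0 \<le> x" "x \<le> m\<^sub>1"
    "p * y + (1 - p) * x = m\<^sub>1" "p * y powr \<alpha> + (1 - p) * x powr \<alpha> = m\<^sub>\<alpha>"
proof -
  have "m\<^sub>1 powr \<alpha> = m\<^sub>1 * m\<^sub>1 powr (\<alpha> - 1)"
    using assms by (simp add: powr_diff)
  with assms have "m\<^sub>1 powr (\<alpha> - 1) < y powr (\<alpha> - 1)"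
    by (smt (verit) mult_less_cancel_left_pos)
  then have "m\<^sub>1 < y"
    using assms by (smt (verit) powr_mono2)
  \<comment> \<open>The weight on \<open>y\<close> that forces the mean to be
    \<open>m\<^sub>1\<close>; the denominator stays positive on \<open>{0..m\<^sub>1}\<close> since
    \<open>m\<^sub>1 < y\<close>.\<close>
  define P where "P x = (m\<^sub>1 - x) / (y - x)" for x
  define \<phi> where "\<phi> x = P x * y powr \<alpha> + (1 - P x) * x powr \<alpha>" for x
  have "continuous_on {0..m\<^sub>1} \<phi>"
    unfolding \<phi>_def P_def using \<open>m\<^sub>1 < y\<close> assms
    by (intro continuous_on_powr' continuous_intros) auto
  moreover have "\<phi> m\<^sub>1 \<le> m\<^sub>\<alpha>"
    using assms by (simp add: \<phi>_def P_def)
  \<comment> \<open>Here \<open>P 0 = m\<^sub>1 / y\<close> and \<open>0 powr \<alpha> = 0\<close>,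
    so \<open>\<phi> 0\<close> is \<open>m\<^sub>1 * y powr (\<alpha> - 1)\<close>.\<close>
  moreover have "\<phi> 0 \<ge> m\<^sub>\<alpha>"
    using assms by (simp add: \<phi>_def P_def powr_diff)
  ultimately obtain x where x: "0 \<le> x" "x \<le> m\<^sub>1" "\<phi> x = m\<^sub>\<alpha>"
    using IVT2'[of \<phi> m\<^sub>1 m\<^sub>\<alpha> 0] assms by auto
  have "x < y" using x \<open>m\<^sub>1 < y\<close> by simp
  show ?thesis
  proof (rule that[of "P x" x])
    show "0 \<le> P x" "P x \<le> 1"
      using x \<open>m\<^sub>1 < y\<close> by (auto simp: P_def)
    have "P x * (y - x) = m\<^sub>1 - x"
      using \<open>x < y\<close> by (simp add: P_def)
    then show "P x * y + (1 - P x) * x = m\<^sub>1"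
      by (simp add: algebra_simps)
  qed (use x in \<open>auto simp: \<phi>_def\<close>)
qed

text \<open>Raising the bound on \<open>q\<close> to the power \<open>\<alpha> - 1\<close> gives
  \<open>B < q powr (\<alpha> - 1)\<close>. Multiplying by \<open>m\<^sub>1 * c\<close> cancels the
  factor \<open>((\<alpha> - 1) / \<alpha>) powr (\<alpha> - 1)\<close> in \<open>B\<close>, and
  \<open>c \<ge> 1\<close> lets \<open>m\<^sub>1 powr \<alpha> * c\<close> dominate
  \<open>m\<^sub>1 powr \<alpha>\<close>.\<close>

lemma q_lower_less_imp:
  fixes \<alpha> m\<^sub>1 m\<^sub>\<alpha> q :: real
  assumes "\<alpha> > 1" "m\<^sub>1 > 0" "m\<^sub>\<alpha> > m\<^sub>1 powr \<alpha>" "q > q_lower m\<^sub>1 m\<^sub>\<alpha> \<alpha>"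
  shows "m\<^sub>\<alpha> < m\<^sub>1 * (\<alpha> * q / (\<alpha> - 1)) powr (\<alpha> - 1)"
proof -
  define c where "c = (\<alpha> / (\<alpha> - 1)) powr (\<alpha> - 1)"
  define B where "B = (m\<^sub>\<alpha> - m\<^sub>1 powr \<alpha>) / m\<^sub>1 * ((\<alpha> - 1) / \<alpha>) powr (\<alpha> - 1) + m\<^sub>1 powr (\<alpha> - 1)"
  have B: "B > 0"
    unfolding B_def using assms by (intro add_pos_pos mult_pos_pos) auto
  have "B powr (1 / (\<alpha> - 1)) < q"
    using assms by (simp add: q_lower_def B_def)
  then have "(B powr (1 / (\<alpha> - 1))) powr (\<alpha> - 1) < q powr (\<alpha> - 1)"
    using assms by (intro powr_less_mono2) auto
  then have Bq: "B < q powr (\<alpha> - 1)"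
    using assms B by (simp add: powr_powr)
  have "q > 0"
    using assms(4) unfolding q_lower_def by (smt (verit) powr_ge_zero)
  have "c \<ge> 1"
    unfolding c_def using assms by (intro ge_one_powr_ge_zero) auto
  have cinv: "((\<alpha> - 1) / \<alpha>) powr (\<alpha> - 1) * c = 1"
    unfolding c_def using assms by (simp add: powr_divide)
  have m: "m\<^sub>1 powr \<alpha> = m\<^sub>1 * m\<^sub>1 powr (\<alpha> - 1)"
    using assms by (simp add: powr_diff)
  have "m\<^sub>\<alpha> = (m\<^sub>\<alpha> - m\<^sub>1 powr \<alpha>) + m\<^sub>1 powr \<alpha>" by simp
  also have "\<dots> \<le> (m\<^sub>\<alpha> - m\<^sub>1 powr \<alpha>) + m\<^sub>1 powr \<alpha> * c"
    using \<open>c \<ge> 1\<close> by (simp add: mult_le_cancel_left1)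
  also have "\<dots> = (m\<^sub>\<alpha> - m\<^sub>1 powr \<alpha>) * (((\<alpha> - 1) / \<alpha>) powr (\<alpha> - 1) * c) + m\<^sub>1 powr \<alpha> * c"
    unfolding cinv by simp
  also have "\<dots> = m\<^sub>1 * (B * c)"
    unfolding B_def using assms(2) by (simp add: field_simps m)
  also have "\<dots> < m\<^sub>1 * (q powr (\<alpha> - 1) * c)"
    using Bq \<open>c \<ge> 1\<close> assms(2) by simp
  also have "q powr (\<alpha> - 1) * c = (\<alpha> * q / (\<alpha> - 1)) powr (\<alpha> - 1)"
    unfolding c_def using assms \<open>q > 0\<close> by (simp add: powr_mult[symmetric] mult.commute)
  finally show ?thesis .
qed

theorem proposition3p3:
  fixes \<alpha> m\<^sub>1 m\<^sub>\<alpha> q :: real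
  assumes "\<alpha> > 1"
    and "m\<^sub>1 > 0"
    and "m\<^sub>\<alpha> > m\<^sub>1 powr \<alpha>"
    and "q > q_lower m\<^sub>1 m\<^sub>\<alpha> \<alpha>"
  shows "(SUP F\<in>moment_class \<alpha> m\<^sub>1 m\<^sub>\<alpha>. ereal (expected_excess F q))
    \<ge> ereal ((m\<^sub>\<alpha> - m\<^sub>1 powr \<alpha>) / (\<alpha> powr \<alpha> * q powr (\<alpha> - 1)) * (\<alpha> - 1) powr (\<alpha> - 1))"
proof -
  define y where "y = \<alpha> * q / (\<alpha> - 1)"
  have "q > 0"
    using assms(4) unfolding q_lower_def by (smt (verit) powr_ge_zero)
  then have "y > 0"
    using assms(1) by (simp add: y_def)
  have yq: "y - q = q / (\<alpha> - 1)"
    using assms(1) by (simp add: y_def field_simps)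
  then have "y - q > 0"
    using assms(1) \<open>q > 0\<close> by simp
  obtain p x where p: "0 \<le> p" "p \<le> 1" and x: "0 \<le> x" "x \<le> m\<^sub>1"
    and eqs: "p * y + (1 - p) * x = m\<^sub>1" "p * y powr \<alpha> + (1 - p) * x powr \<alpha> = m\<^sub>\<alpha>"
    using exists_two_point[OF assms(1,2) \<open>y > 0\<close> assms(3)] q_lower_less_imp[OF assms]
    unfolding y_def by blast
  \<comment> \<open>As \<open>x \<le> m\<^sub>1\<close>, the lower atom contributes at most
    \<open>m\<^sub>1 powr \<alpha>\<close> to the moment; the atom at \<open>y\<close> must supply
    the rest.\<close>
  have "(1 - p) * x powr \<alpha> \<le> 1 * m\<^sub>1 powr \<alpha>"
    using p x assms(1) by (intro mult_mono powr_mono2) auto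
  then have "m\<^sub>\<alpha> - m\<^sub>1 powr \<alpha> \<le> p * y powr \<alpha>"
    using eqs by simp
  then have le_p: "(m\<^sub>\<alpha> - m\<^sub>1 powr \<alpha>) / y powr \<alpha> \<le> p"
    using \<open>y > 0\<close> by (simp add: pos_divide_le_eq)
  have "(m\<^sub>\<alpha> - m\<^sub>1 powr \<alpha>) / (\<alpha> powr \<alpha> * q powr (\<alpha> - 1)) * (\<alpha> - 1) powr (\<alpha> - 1)
      = (m\<^sub>\<alpha> - m\<^sub>1 powr \<alpha>) / y powr \<alpha> * (y - q)"
    unfolding yq unfolding y_def using assms(1) \<open>q > 0\<close>
    by (simp add: powr_divide powr_mult powr_diff)
  also have "\<dots> \<le> p * (y - q)"
    using le_p \<open>y - q > 0\<close> by (intro mult_right_mono) auto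
  also have "\<dots> \<le> p * max 0 (y - q) + (1 - p) * max 0 (x - q)"
    using p \<open>y - q > 0\<close> by simp
  also have "\<dots> = expected_excess (two_point p x y) q"
    unfolding expected_excess_def using p x \<open>y > 0\<close>
    by (subst integral_two_point) auto
  \<comment> \<open>The supremum lives in the complete lattice \<open>ereal\<close>, so one member
    of the class suffices, with no boundedness to check.\<close>
  finally show ?thesis
    using two_point_in_moment_class[OF p x(1) _ eqs] \<open>y > 0\<close>
    by (intro SUP_upper2[of "two_point p x y"]) auto
qed

end
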